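(* Let $\mathcal{X}$ be a linear vector field on $SO(3)$ with linear flow $\varphi_t$, and let $X$ be the right invariant vector field associated to $\mathcal{X}$, given by $$X=\begin{pmatrix}0&-z&y\\ z&0&-x\\ -y&x&0\end{pmatrix}\in\mathfrak{so}(3),\qquad x,y,z\in\mathbb{R}.$$ Then: (i) every orbit of the invariant flow $\exp(tX)$ that is not a fixed point is periodic; (ii) every orbit of the linear flow $\varphi_t$ that is not a fixed point is periodic. Furthermore, the period is $T=2\pi/\sqrt{x^2+y^2+z^2}$.
   Context: A vector field $\mathcal{X}$ on a Lie group $G$ is called linear if its flow $(\varphi_t)_{t\in\mathbb{R}}$ is a family of automorphisms of the Lie group $G$; $\varphi_t$ is then called the linear flow. For semisimple $G$ there is a right invariant vector field $X$ (identified with an element of the Lie algebra) such that $\mathcal{X}=X+I_*X$, where $I_*$ is the differential of the inversion $g\mapsto g^{-1}$; equivalently $\varphi_t(g)=\exp(tX)\,g\,\exp(-tX)$. The invariant flow of $X$ is $g\mapsto\exp(tX)g$. An orbit is periodic if its orbit curve $c$ satisfies $c(t+s)=c(t)$ for all $t\in\mathbb{R}$, for some $s>0$. *)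

theory Defs
  imports "HOL-Analysis.Analysis" "HOL-Algebra.Group"
begin

type_synonym mat3 = "real^3^3"

text \<open>The group \<open>SO(3)\<close>, regarded as an embedded submanifold of the space of real
  \<open>3 \<times> 3\<close> matrices.\<close>

definition SO3 :: "mat3 monoid" where
  "SO3 = \<lparr>carrier = {A. rotation_matrix A}, mult = (\<lambda>A B. A ** B), one = mat 1\<rparr>"

text \<open>\<open>C\<^sup>k\<close> maps on an open set of a Euclidean space, by recursion on the directional
  derivatives; the set is assumed open wherever these predicates are used.\<close>

primrec Ck_on :: "nat \<Rightarrow> ('a::euclidean_space \<Rightarrow> 'b::real_normed_vector) \<Rightarrow> 'a set \<Rightarrow> bool" where
  "Ck_on 0 f U \<longleftrightarrow> continuous_on U f"
| "Ck_on (Suc k) f U \<longleftrightarrow> (\<forall>p\<in>U. f differentiable (at p)) \<and>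
     (\<forall>v. Ck_on k (\<lambda>p. frechet_derivative f (at p) v) U)"

text \<open>Smoothness of a map on a submanifold \<open>M\<close>: locally the restriction of a \<open>C\<^sup>\<infinity>\<close> map of the
  ambient space.\<close>

definition smooth_map_on :: "'a::euclidean_space set \<Rightarrow> ('a \<Rightarrow> 'b::real_normed_vector) \<Rightarrow> bool" where
  "smooth_map_on M f \<longleftrightarrow> (\<forall>p\<in>M. \<exists>U F. open U \<and> p \<in> U \<and> (\<forall>k. Ck_on k F U) \<and> (\<forall>q\<in>M \<inter> U. F q = f q))"

definition tangent_space :: "'a::real_normed_vector set \<Rightarrow> 'a \<Rightarrow> 'a set" where
  "tangent_space M p =
     {v. \<exists>c. c (0::real) = p \<and> (\<forall>t. c t \<in> M) \<and> (c has_vector_derivative v) (at 0)}"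

definition vector_field_on :: "'a::euclidean_space set \<Rightarrow> ('a \<Rightarrow> 'a) \<Rightarrow> bool" where
  "vector_field_on M V \<longleftrightarrow> smooth_map_on M V \<and> (\<forall>p\<in>M. V p \<in> tangent_space M p)"

definition is_flow_on ::
  "'a::real_normed_vector set \<Rightarrow> ('a \<Rightarrow> 'a) \<Rightarrow> (real \<Rightarrow> 'a \<Rightarrow> 'a) \<Rightarrow> bool" where
  "is_flow_on M V \<phi> \<longleftrightarrow> (\<forall>p\<in>M. \<phi> 0 p = p \<and>
     (\<forall>t. \<phi> t p \<in> M \<and> ((\<lambda>s. \<phi> s p) has_vector_derivative V (\<phi> t p)) (at t)))"

definition lie_automorphism :: "('a::euclidean_space) monoid \<Rightarrow> ('a \<Rightarrow> 'a) \<Rightarrow> bool" where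
  "lie_automorphism G f \<longleftrightarrow> f \<in> iso G G \<and>
     smooth_map_on (carrier G) f \<and> smooth_map_on (carrier G) (inv_into (carrier G) f)"

definition linear_vector_field :: "('a::euclidean_space) monoid \<Rightarrow> ('a \<Rightarrow> 'a) \<Rightarrow> bool" where
  "linear_vector_field G V \<longleftrightarrow> vector_field_on (carrier G) V \<and>
     (\<exists>\<phi>. is_flow_on (carrier G) V \<phi> \<and> (\<forall>t. lie_automorphism G (\<phi> t)))"

text \<open>Push-forward of the vector field \<open>Y\<close> along a diffeomorphism \<open>F\<close> with inverse \<open>F'\<close>.
  Here \<open>F\<close> is the restriction to the submanifold of a map that is differentiable in a
  neighbourhood of it, so the differential is the restriction of the ambient derivative.\<close>

definition pushforward ::
  "('a::real_normed_vector \<Rightarrow> 'a) \<Rightarrow> ('a \<Rightarrow> 'a) \<Rightarrow> ('a \<Rightarrow> 'a) \<Rightarrow> 'a \<Rightarrow> 'a" where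
  "pushforward F F' Y p = frechet_derivative F (at (F' p)) (Y (F' p))"

definition right_invariant_field :: "(mat3 \<Rightarrow> mat3) \<Rightarrow> bool" where
  "right_invariant_field Y \<longleftrightarrow> vector_field_on (carrier SO3) Y \<and>
     (\<forall>h\<in>carrier SO3. \<forall>g\<in>carrier SO3.
        pushforward (\<lambda>a. a ** h) (\<lambda>a. a ** matrix_inv h) Y g = Y g)"

text \<open>The relation \<open>V = Y + I\<^sub>* Y\<close> on \<open>SO(3)\<close>, where \<open>I\<close> is the inversion. Since \<open>matrix_inv\<close> is
  smooth on the open set of invertible matrices, its ambient derivative may be used for \<open>I\<^sub>*\<close>.\<close>

definition associated_right_invariant_field :: "(mat3 \<Rightarrow> mat3) \<Rightarrow> (mat3 \<Rightarrow> mat3) \<Rightarrow> bool" where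
  "associated_right_invariant_field V Y \<longleftrightarrow> right_invariant_field Y \<and>
     (\<forall>g\<in>carrier SO3. V g = Y g + pushforward matrix_inv matrix_inv Y g)"

text \<open>The type of square matrices is not an instance of the class for which \<open>exp\<close> is defined.\<close>

definition mat_exp :: "real^'n^'n \<Rightarrow> real^'n^'n" where
  "mat_exp A = (\<Sum>n. (1 / fact n) *\<^sub>R (((\<lambda>B. A ** B) ^^ n) (mat 1)))"

definition so3_matrix :: "real \<Rightarrow> real \<Rightarrow> real \<Rightarrow> mat3" where
  "so3_matrix x y z = vector [vector [0, -z, y], vector [z, 0, -x], vector [-y, x, 0]]"

definition invariant_flow :: "mat3 \<Rightarrow> real \<Rightarrow> mat3 \<Rightarrow> mat3" where
  "invariant_flow X t g = mat_exp (t *\<^sub>R X) ** g"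

definition fixed_point :: "(real \<Rightarrow> 'a \<Rightarrow> 'a) \<Rightarrow> 'a \<Rightarrow> bool" where
  "fixed_point \<phi> p \<longleftrightarrow> (\<forall>t. \<phi> t p = p)"

definition is_period :: "(real \<Rightarrow> 'a) \<Rightarrow> real \<Rightarrow> bool" where
  "is_period c s \<longleftrightarrow> s > 0 \<and> (\<forall>t. c (t + s) = c t)"

definition periodic_orbit :: "(real \<Rightarrow> 'a \<Rightarrow> 'a) \<Rightarrow> 'a \<Rightarrow> bool" where
  "periodic_orbit \<phi> p \<longleftrightarrow> (\<exists>s. is_period (\<lambda>t. \<phi> t p) s)"

definition least_period :: "(real \<Rightarrow> 'a) \<Rightarrow> real \<Rightarrow> bool" where
  "least_period c s \<longleftrightarrow> is_period c s \<and> (\<forall>r. is_period c r \<longrightarrow> s \<le> r)"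

text \<open>The period of a flow on \<open>M\<close>: the least common period of its orbits. For the linear flow on
  \<open>SO(3)\<close> this need not be the least period of each single non-fixed orbit: if \<open>g\<close> is the
  half-turn about an axis orthogonal to \<open>(x, y, z)\<close>, then conjugating \<open>g\<close> by the half-turn about
  \<open>(x, y, z)\<close> gives back \<open>g\<close>, so the orbit of \<open>g\<close> closes up after half the period of the flow.\<close>

definition flow_period :: "'a set \<Rightarrow> (real \<Rightarrow> 'a \<Rightarrow> 'a) \<Rightarrow> real \<Rightarrow> bool" where
  "flow_period M \<phi> s \<longleftrightarrow> (\<forall>p\<in>M. is_period (\<lambda>t. \<phi> t p) s) \<and>
     (\<forall>r. (\<forall>p\<in>M. is_period (\<lambda>t. \<phi> t p) r) \<longrightarrow> s \<le> r)"

end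

theory Submission imports Defs begin

text \<open>Right invariance gives \<open>Y g = X g\<close>, and the differential of the inversion at \<open>g\<^bsup>-1\<^esup>\<close> is
  \<open>H \<mapsto> - g H g\<close>, so \<open>V g = X g - g X\<close> and, by uniqueness of solutions, \<open>\<phi>\<^sub>t g = e\<^bsup>tX\<^esup> g e\<^bsup>-tX\<^esup>\<close>.
  Since \<open>X\<^sup>3 = - w\<^sup>2 X\<close> with \<open>w\<^sup>2 = x\<^sup>2 + y\<^sup>2 + z\<^sup>2\<close>, the exponential is given by Rodrigues' formula and has
  least period \<open>2\<pi>/w\<close>. A common period \<open>r\<close> of all linear orbits makes \<open>e\<^bsup>rX\<^esup>\<close> commute with every
  rotation, hence scalar; it fixes the axis \<open>(x, y, z)\<close>, so it is the identity.\<close>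

section \<open>The matrix product and the matrix inverse\<close>

interpretation matrix_mult: bounded_bilinear "(**) :: real^'n^'m \<Rightarrow> real^'p^'n \<Rightarrow> real^'p^'m"
proof -
  have "bilinear ((**) :: real^'n^'m \<Rightarrow> real^'p^'n \<Rightarrow> real^'p^'m)"
    unfolding bilinear_def
    by (auto intro!: linearI simp: matrix_add_ldistrib matrix_scalar_ac scalar_matrix_assoc
        vec_eq_iff matrix_matrix_mult_def sum.distrib algebra_simps sum_distrib_left)
  then show "bounded_bilinear ((**) :: real^'n^'m \<Rightarrow> real^'p^'n \<Rightarrow> real^'p^'m)"
    by (simp add: bilinear_conv_bounded_bilinear)
qed

text \<open>\<open>matrix_inv\<close> is defined by choice; a one-sided inverse of a square matrix
  is two-sided, which leaves only one candidate.\<close>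

lemma matrix_inv_unique:
  fixes A B :: "'a::field^'n^'n"
  assumes "A ** B = mat 1"
  shows "matrix_inv A = B"
proof -
  have BA: "B ** A = mat 1"
    using assms by (simp add: matrix_left_right_inverse)
  then have "A ** matrix_inv A = mat 1"
    using assms unfolding matrix_inv_def by (metis (mono_tags, lifting) someI_ex)
  then show ?thesis
    by (metis BA matrix_mul_assoc matrix_mul_lid matrix_mul_rid)
qed

lemma matrix_inv_mult:
  fixes A :: "'a::field^'n^'n"
  assumes "invertible A"
  shows "A ** matrix_inv A = mat 1" "matrix_inv A ** A = mat 1"
  using assms matrix_inv_unique unfolding invertible_def by metis+

section \<open>Differentiability of the determinant and of inversion\<close>

lemma differentiable_matrix_component:
  fixes f :: "'a::real_normed_vector \<Rightarrow> real^'m^'n"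
  assumes "f differentiable F"
  shows "(\<lambda>x. f x $ i $ j) differentiable F"
proof -
  obtain f' where "(f has_derivative f') F"
    using assms by (auto simp: differentiable_def)
  then have "((\<lambda>x. f x $ i $ j) has_derivative (\<lambda>x. f' x $ i $ j)) F"
    by (intro bounded_linear.has_derivative[OF bounded_linear_vec_nth])
  then show ?thesis
    by (auto simp: differentiable_def)
qed

lemma differentiable_matrixI:
  fixes f :: "'a::real_normed_vector \<Rightarrow> real^'m^'n"
  assumes "\<And>i j. (\<lambda>x. f x $ i $ j) differentiable (at a within S)"
  shows "f differentiable (at a within S)"
  by (subst differentiable_componentwise_within)
    (auto simp: Basis_vec_def inner_axis assms)

text \<open>By the Leibniz formula the determinant is a sum of products of entries.\<close>

lemma differentiable_det:
  fixes f :: "'a::real_normed_vector \<Rightarrow> real^'n^'n"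
  assumes "\<And>i j. (\<lambda>x. f x $ i $ j) differentiable (at a within S)"
  shows "(\<lambda>x. det (f x)) differentiable (at a within S)"
proof -
  have "(\<lambda>x. \<Prod>i\<in>UNIV. f x $ i $ p i) differentiable (at a within S)" for p
  proof -
    have "\<forall>i. \<exists>f'. ((\<lambda>x. f x $ i $ p i) has_derivative f') (at a within S)"
      using assms by (simp add: differentiable_def)
    then obtain f' where f': "\<And>i. ((\<lambda>x. f x $ i $ p i) has_derivative f' i) (at a within S)"
      by metis
    show ?thesis
      by (rule differentiableI[OF has_derivative_prod, OF f'])
  qed
  then show ?thesis
    unfolding det_def by (intro differentiable_sum finite_permutations ballI) auto
qed

lemma open_det_nonzero: "open {A :: real^'n^'n. det A \<noteq> 0}"
    by (intro open_Collect_neq continuous_at_imp_continuous_on ballI continuous_const)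
      (auto intro!: differentiable_imp_continuous_within differentiable_det
        differentiable_matrix_component)

text \<open>Column \<open>j\<close> of the inverse solves \<open>A *v u = column j (mat 1)\<close>,
  so Cramer's rule applies. This exhibits the entries as quotients of differentiable
  functions.\<close>

lemma matrix_inv_cramer:
  fixes A :: "real^'n^'n"
  assumes "det A \<noteq> 0"
  shows "matrix_inv A $ k $ j = det (\<chi> i l. if l = k then mat 1 $ i $ j else A $ i $ l) / det A"
proof -
  have "A ** matrix_inv A = mat 1"
    using assms by (simp add: matrix_inv_mult invertible_det_nz)
  then have "A *v column j (matrix_inv A) = column j (mat 1)"
    by (metis matrix_vector_mul_assoc matrix_vector_mult_basis)
  then have "column j (matrix_inv A) =
      (\<chi> k. det (\<chi> i l. if l = k then column j (mat 1) $ i else A $ i $ l) / det A)"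
    using cramer[OF assms] by blast
  then show ?thesis
    by (simp add: column_def vec_eq_iff cong: if_cong)
qed

lemma differentiable_matrix_inv:
  fixes A :: "real^'n^'n"
  assumes "det A \<noteq> 0"
  shows "matrix_inv differentiable (at A)"
proof -
  let ?f = "\<lambda>B::real^'n^'n. \<chi> k j.
    det (\<chi> i l. if l = k then mat 1 $ i $ j else B $ i $ l) / det B"
  have "?f differentiable (at A)"
  proof (rule differentiable_matrixI)
    fix k j
    have "(\<lambda>B::real^'n^'n. if l = k then mat 1 $ i $ j else B $ i $ l) differentiable (at A)" for i l
      by (cases "l = k") (simp_all add: differentiable_matrix_component)
    then have "(\<lambda>B::real^'n^'n. det (\<chi> i l. if l = k then mat 1 $ i $ j else B $ i $ l))
        differentiable (at A)"
      by (intro differentiable_det) simp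
    then show "(\<lambda>B. ?f B $ k $ j) differentiable (at A)"
      using assms by (simp add: differentiable_det differentiable_matrix_component)
  qed
  then obtain f' where "(?f has_derivative f') (at A)"
    by (auto simp: differentiable_def)
  then have "(matrix_inv has_derivative f') (at A)"
    \<comment> \<open>Cramer's quotients agree with \<open>matrix_inv\<close> only where the
      determinant is nonzero; that set is open, so the derivative carries over.\<close>
    by (rule has_derivative_transform_within_open[OF _ open_det_nonzero])
      (use assms in \<open>auto simp: vec_eq_iff matrix_inv_cramer\<close>)
  then show ?thesis
    by (auto simp: differentiable_def)
qed

text \<open>Differentiate the identity \<open>B ** matrix_inv B = mat 1\<close>, valid near
  \<open>A\<close>, by the product rule and solve for the derivative of the inverse.\<close>

lemma frechet_derivative_matrix_inv:
  fixes A H :: "real^'n^'n"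
  assumes "det A \<noteq> 0"
  shows "frechet_derivative matrix_inv (at A) H = - (matrix_inv A ** H ** matrix_inv A)"
proof -
  let ?D = "frechet_derivative matrix_inv (at A)"
  have "(matrix_inv has_derivative ?D) (at A)"
    using differentiable_matrix_inv[OF assms] by (simp add: frechet_derivative_works)
  then have "((\<lambda>B. B ** matrix_inv B) has_derivative (\<lambda>H. A ** ?D H + H ** matrix_inv A)) (at A)"
    by (intro matrix_mult.FDERIV[OF has_derivative_ident])
  moreover have "((\<lambda>B. B ** matrix_inv B) has_derivative (\<lambda>H. 0)) (at A)"
    by (rule has_derivative_transform_within_open[OF has_derivative_const[of "mat 1"] open_det_nonzero])
      (use assms in \<open>auto simp: matrix_inv_mult invertible_det_nz\<close>)
  ultimately have "A ** ?D H + H ** matrix_inv A = 0"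
    by (rule has_derivative_unique[THEN fun_cong])
  then have "A ** ?D H = - (H ** matrix_inv A)"
    by (simp only: eq_neg_iff_add_eq_0)
  then have "matrix_inv A ** (A ** ?D H) = matrix_inv A ** (- (H ** matrix_inv A))"
    by (simp only:)
  then show ?thesis
    using assms by (simp add: matrix_mul_assoc matrix_inv_mult invertible_det_nz matrix_mult.minus_right)
qed

section \<open>The exponential of a matrix with
  \<open>X ** X ** X = - w\<^sup>2 *\<^sub>R X\<close>\<close>

text \<open>When \<open>w = 0\<close>, the second assumption together with \<open>a / 0 = 0\<close> keeps the closed formula for
  the exponential valid.\<close>

locale rotation_generator =
  fixes X :: "real^'n^'n" and w :: real
  assumes cube: "X ** X ** X = - w\<^sup>2 *\<^sub>R X"
    and speed_0: "w = 0 \<longleftrightarrow> X = 0"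
begin

text \<open>This is Rodrigues' formula. The cube relation reduces every positive power of
  \<open>X\<close> to a multiple of \<open>X\<close> or of \<open>X ** X\<close>; odd powers collect
  into the sine series, even ones into the cosine series.\<close>

lemma mat_exp_sums:
  "(\<lambda>n. (1 / fact n) *\<^sub>R (((\<lambda>B. (t *\<^sub>R X) ** B) ^^ n) (mat 1))) sums
    (mat 1 + (sin (w * t) / w) *\<^sub>R X + ((1 - cos (w * t)) / w\<^sup>2) *\<^sub>R (X ** X))"
proof -
  \<comment> \<open>\<open>e0\<close> is the part of \<open>mat 1\<close> annihilated by
    \<open>X\<close>. Splitting it off makes the term \<open>n = 0\<close> fit the cosine pattern,
    and later terms receive nothing from it.\<close>
  define e0 where "e0 = mat 1 + (1 / w\<^sup>2) *\<^sub>R (X ** X)"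
  have summand: "(1 / fact n) *\<^sub>R (((\<lambda>B. (t *\<^sub>R X) ** B) ^^ n) (mat 1)) =
      (if n = 0 then e0 else 0) + (sin_coeff n * (w * t) ^ n / w) *\<^sub>R X
      - (cos_coeff n * (w * t) ^ n / w\<^sup>2) *\<^sub>R (X ** X)" (is "?l n = ?r n") for n
  proof (induction n)
    case 0
    then show ?case
      by (simp add: e0_def)
  next
    case (Suc n)
    have Xe0: "X ** e0 = 0"
      using speed_0 cube by (cases "w = 0")
        (auto simp: e0_def matrix_mult.add_right matrix_mult.scaleR_right matrix_mul_assoc)
    have "?l (Suc n) = (t / real (Suc n)) *\<^sub>R (X ** ?l n)"
      by (simp add: matrix_mult.scaleR_left matrix_mult.scaleR_right field_simps)
    also have "\<dots> = (t / real (Suc n)) *\<^sub>R (X ** ?r n)"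
      by (simp only: Suc)
    \<comment> \<open>Multiplication by \<open>X\<close> swaps the roles of sine and cosine; the
      cube relation cancels the denominator \<open>w\<^sup>2\<close>.\<close>
    also have "X ** ?r n = (sin_coeff n * (w * t) ^ n / w) *\<^sub>R (X ** X)
        + (cos_coeff n * (w * t) ^ n) *\<^sub>R X"
      using Xe0 speed_0 cube by (cases "w = 0")
        (auto simp: matrix_mult.add_right matrix_mult.diff_right matrix_mult.scaleR_right
          matrix_mul_assoc)
    also have "(t / real (Suc n)) *\<^sub>R \<dots> = ?r (Suc n)"
    proof (cases "w = 0")
      case True
      then show ?thesis
        using speed_0 by simp
    next
      case False
      have "t / real (Suc n) * (cos_coeff n * (w * t) ^ n) = sin_coeff (Suc n) * (w * t) ^ Suc n / w"
        "t / real (Suc n) * (sin_coeff n * (w * t) ^ n / w) =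
          - (cos_coeff (Suc n) * (w * t) ^ Suc n / w\<^sup>2)"
        using False by (simp_all add: sin_coeff_Suc cos_coeff_Suc power2_eq_square)
      then show ?thesis
        by (simp only: scaleR_add_right scaleR_scaleR) simp
    qed
    finally show ?case .
  qed
  have "(\<lambda>n. (if n = 0 then e0 else 0) + (sin_coeff n * (w * t) ^ n / w) *\<^sub>R X
      - (cos_coeff n * (w * t) ^ n / w\<^sup>2) *\<^sub>R (X ** X)) sums
      (e0 + (sin (w * t) / w) *\<^sub>R X - (cos (w * t) / w\<^sup>2) *\<^sub>R (X ** X))"
    using sin_converges[of "w * t"] cos_converges[of "w * t"]
    by (intro sums_diff sums_add sums_scaleR_left sums_divide sums_single) simp_all
  then show ?thesis
    unfolding summand by (simp add: e0_def diff_divide_distrib scaleR_diff_left algebra_simps)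
qed

lemmas mat_exp_eq = mat_exp_sums[THEN sums_unique, symmetric, folded mat_exp_def]

lemma mat_exp_0: "mat_exp (0 :: real^'n^'n) = mat 1"
  using mat_exp_eq[of 0] by simp

lemma mat_exp_commute: "mat_exp (t *\<^sub>R X) ** X = X ** mat_exp (t *\<^sub>R X)"
  by (simp add: mat_exp_eq matrix_mult.add_left matrix_mult.add_right matrix_mult.scaleR_left
      matrix_mult.scaleR_right matrix_mul_assoc)

text \<open>Differentiate the closed formula; the cube relation identifies the result. For
  \<open>w = 0\<close> the exponential is constant.\<close>

lemma mat_exp_has_vector_derivative:
  "((\<lambda>t. mat_exp (t *\<^sub>R X)) has_vector_derivative X ** mat_exp (t *\<^sub>R X)) (at t)"
proof (cases "w = 0")
  case True
  then show ?thesis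
    using speed_0 by (simp add: mat_exp_eq)
next
  case False
  have "((\<lambda>t. mat_exp (t *\<^sub>R X)) has_vector_derivative
      cos (w * t) *\<^sub>R X + (sin (w * t) / w) *\<^sub>R (X ** X)) (at t)"
    unfolding mat_exp_eq using False
    by (auto intro!: derivative_eq_intros simp: power2_eq_square)
  also have "cos (w * t) *\<^sub>R X + (sin (w * t) / w) *\<^sub>R (X ** X) = X ** mat_exp (t *\<^sub>R X)"
    using False cube by (simp add: mat_exp_eq matrix_mult.add_right matrix_mult.scaleR_right
      matrix_mul_assoc scaleR_diff_left)
  finally show ?thesis .
qed

lemma mat_exp_minus_has_vector_derivative:
  "((\<lambda>t. mat_exp (- t *\<^sub>R X)) has_vector_derivative - (X ** mat_exp (- t *\<^sub>R X))) (at t)"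
  using vector_diff_chain_at[OF has_vector_derivative_minus[OF has_vector_derivative_id]
      mat_exp_has_vector_derivative[of "- t"]]
  by (simp add: o_def)

section \<open>The commutator equation and its solutions\<close>

text \<open>Pulling a solution back by the exponentials gives a curve with zero derivative, since
  \<open>X\<close> commutes with its exponential. This takes the place of a general uniqueness
  theorem for differential equations.\<close>

lemma conjugation_ode_unique:
  assumes "\<And>t. (c has_vector_derivative X ** c t - c t ** X) (at t)"
  shows "mat_exp (- t *\<^sub>R X) ** c t ** mat_exp (t *\<^sub>R X) = c 0"
proof -
  let ?E = "\<lambda>t. mat_exp (t *\<^sub>R X)"
  have "((\<lambda>t. ?E (- t) ** c t ** ?E t) has_vector_derivative 0) (at t)" for t
  proof -
    have "((\<lambda>t. ?E (- t) ** c t ** ?E t) has_vector_derivative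
        (?E (- t) ** c t) ** (X ** ?E t)
        + (?E (- t) ** (X ** c t - c t ** X) + - (X ** ?E (- t)) ** c t) ** ?E t) (at t)"
      by (intro matrix_mult.has_vector_derivative mat_exp_minus_has_vector_derivative assms
          mat_exp_has_vector_derivative)
    then show ?thesis
      using mat_exp_commute[of "- t"]
      by (simp add: matrix_mult.add_left matrix_mult.diff_left matrix_mult.diff_right
          matrix_mult.minus_left matrix_mul_assoc)
  qed
  then obtain b where "\<And>t. ?E (- t) ** c t ** ?E t = b"
    by (rule has_vector_derivative_zero_constant[OF convex_UNIV, simplified]) blast
  from this[of t] this[of 0] show ?thesis
    by (simp add: mat_exp_0)
qed

text \<open>The constant curve \<open>mat 1\<close> solves the commutator equation.\<close>

lemma mat_exp_inverse: "mat_exp (- t *\<^sub>R X) ** mat_exp (t *\<^sub>R X) = mat 1"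
  using conjugation_ode_unique[of "\<lambda>_. mat 1"] by (simp add: mat_exp_eq)

lemma conjugation_flow:
  assumes "\<And>t. (c has_vector_derivative X ** c t - c t ** X) (at t)"
  shows "c t = mat_exp (t *\<^sub>R X) ** c 0 ** mat_exp (- t *\<^sub>R X)"
proof -
  let ?E = "\<lambda>t. mat_exp (t *\<^sub>R X)"
  have "?E t ** c 0 ** ?E (- t) = ?E t ** (?E (- t) ** c t ** ?E t) ** ?E (- t)"
    by (simp only: conjugation_ode_unique[OF assms])
  also have "\<dots> = (?E t ** ?E (- t)) ** c t ** (?E t ** ?E (- t))"
    by (simp only: matrix_mul_assoc)
  also have "\<dots> = c t"
    using mat_exp_inverse[of "- t"] by simp
  finally show ?thesis ..
qed

section \<open>Periods of the exponential\<close>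

lemma mat_exp_periodic:
  assumes "w \<noteq> 0"
  shows "mat_exp ((t + 2 * pi / w) *\<^sub>R X) = mat_exp (t *\<^sub>R X)"
  using assms by (simp add: mat_exp_eq distrib_left)

lemma period_le:
  assumes "mat_exp (r *\<^sub>R X) = mat 1" and "r > 0" and "w > 0"
  shows "2 * pi / w \<le> r"
proof -
  \<comment> \<open>Multiplying \<open>a X + b X\<^sup>2 = 0\<close> by \<open>X\<close> gives a second relation; eliminating \<open>X\<^sup>2\<close> leaves a
    sum of squares times \<open>X\<close>.\<close>
  define a b where "a = sin (w * r) / w" and "b = (1 - cos (w * r)) / w\<^sup>2"
  have 1: "a *\<^sub>R X + b *\<^sub>R (X ** X) = 0"
    using assms(1) by (simp add: mat_exp_eq a_def b_def add.assoc)
  then have "X ** (a *\<^sub>R X + b *\<^sub>R (X ** X)) = 0"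
    by simp
  then have 2: "a *\<^sub>R (X ** X) - (b * w\<^sup>2) *\<^sub>R X = 0"
    using cube by (simp add: matrix_mult.add_right matrix_mult.scaleR_right matrix_mul_assoc)
  have "(a\<^sup>2 + b\<^sup>2 * w\<^sup>2) *\<^sub>R X =
      a *\<^sub>R (a *\<^sub>R X + b *\<^sub>R (X ** X)) - b *\<^sub>R (a *\<^sub>R (X ** X) - (b * w\<^sup>2) *\<^sub>R X)"
    by (simp add: scaleR_add_right scaleR_diff_right scaleR_add_left power2_eq_square mult_ac)
  then have "a\<^sup>2 + b\<^sup>2 * w\<^sup>2 = 0"
    using 1 2 speed_0 assms(3) by simp
  \<comment> \<open>The cosine decides: it equals 1 exactly at the integer multiples of 2
    pi.\<close>
  then have "b = 0"
    using assms(3) by (simp add: add_nonneg_eq_0_iff)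
  then have "cos (w * r) = 1"
    using assms(3) by (simp add: b_def)
  moreover have "w * r > 0"
    using assms by simp
  ultimately obtain n :: int where n: "w * r = of_int n * 2 * pi"
    unfolding cos_one_2pi_int by blast
  with \<open>w * r > 0\<close> have "n \<ge> 1"
    by (simp add: zero_less_mult_iff)
  then have "1 * (2 * pi) \<le> of_int n * (2 * pi)"
    by (intro mult_right_mono) auto
  with n have "2 * pi \<le> r * w"
    by (simp add: mult_ac)
  then show ?thesis
    using assms(3) by (simp add: pos_divide_le_eq)
qed

end

section \<open>Rotations of three-dimensional space\<close>

lemmas mat3_simps = vec_eq_iff forall_3 sum_3 matrix_matrix_mult_def mat_def

text \<open>The cube relation is Cayley-Hamilton: the characteristic polynomial is
  \<open>l^3 + (x\<^sup>2 + y\<^sup>2 + z\<^sup>2) * l\<close>.\<close>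

lemma rotation_generator_so3:
  "rotation_generator (so3_matrix x y z) (sqrt (x\<^sup>2 + y\<^sup>2 + z\<^sup>2))"
proof
  show "so3_matrix x y z ** so3_matrix x y z ** so3_matrix x y z =
      - (sqrt (x\<^sup>2 + y\<^sup>2 + z\<^sup>2))\<^sup>2 *\<^sub>R so3_matrix x y z"
    by (simp add: mat3_simps so3_matrix_def power2_eq_square algebra_simps)
  have "x\<^sup>2 + y\<^sup>2 + z\<^sup>2 = 0 \<longleftrightarrow> x = 0 \<and> y = 0 \<and> z = 0"
    by (simp add: add_nonneg_eq_0_iff)
  then show "sqrt (x\<^sup>2 + y\<^sup>2 + z\<^sup>2) = 0 \<longleftrightarrow> so3_matrix x y z = 0"
    by (auto simp: mat3_simps so3_matrix_def)
qed

lemma commutes_rotations_imp_scalar: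
  fixes M :: mat3
  assumes "\<And>g. rotation_matrix g \<Longrightarrow> M ** g = g ** M"
  obtains l where "M = l *\<^sub>R mat 1"
proof -
  \<comment> \<open>Two test rotations suffice. The half-turn \<open>?D\<close> about the first axis
    kills the off-diagonal entries of the first row and column; the cyclic permutation
    \<open>?P\<close> of the axes moves these zeros to the remaining off-diagonal places and equates
    the diagonal entries.\<close>
  let ?D = "vector [vector [1, 0, 0], vector [0, -1, 0], vector [0, 0, -1]] :: mat3"
  let ?P = "vector [vector [0, 1, 0], vector [0, 0, 1], vector [1, 0, 0]] :: mat3"
  have "rotation_matrix ?D" "rotation_matrix ?P"
    by (auto simp: rotation_matrix_def orthogonal_matrix det_3 transpose_def mat3_simps)
  then have D: "(M ** ?D) $ i $ j = (?D ** M) $ i $ j"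
    and P: "(M ** ?P) $ i $ j = (?P ** M) $ i $ j" for i j
    by (simp_all only: assms)
  have "M $ 1 $ 2 = 0" "M $ 1 $ 3 = 0" "M $ 2 $ 1 = 0" "M $ 3 $ 1 = 0"
    using D[of 1 2] D[of 1 3] D[of 2 1] D[of 3 1] by (simp_all add: mat3_simps)
  moreover have "M $ 2 $ 2 = M $ 1 $ 1" "M $ 3 $ 3 = M $ 2 $ 2" "M $ 2 $ 3 = M $ 1 $ 2"
    "M $ 3 $ 2 = M $ 1 $ 3"
    using P[of 1 2] P[of 2 3] P[of 1 3] P[of 3 3] by (simp_all add: mat3_simps)
  ultimately have "M = (M $ 1 $ 1) *\<^sub>R mat 1"
    by (simp add: mat3_simps)
  then show thesis
    by (rule that)
qed

text \<open>\<open>so3_matrix x y z\<close> acts as the cross product with \<open>(x, y, z)\<close>,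
  so it kills this vector and only the term \<open>mat 1\<close> of the exponential
  contributes.\<close>

lemma mat_exp_so3_axis:
  "mat_exp (t *\<^sub>R so3_matrix x y z) *v vector [x, y, z] = vector [x, y, z]"
proof -
  interpret rotation_generator "so3_matrix x y z" "sqrt (x\<^sup>2 + y\<^sup>2 + z\<^sup>2)"
    by (rule rotation_generator_so3)
  have "so3_matrix x y z *v vector [x, y, z] = 0"
    by (simp add: vec_eq_iff forall_3 matrix_vector_mult_def sum_3 so3_matrix_def)
  then show ?thesis
    by (simp add: mat_exp_eq matrix_vector_mult_add_rdistrib scaleR_matrix_vector_assoc[symmetric]
        matrix_vector_mul_assoc[symmetric])
qed

text \<open>All rotations \<open>g\<close> enter because a single one may commute with the
  exponential at an earlier time. Together they force a scalar matrix, and the fixed axis forces the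
  scalar 1.\<close>

lemma conjugation_period_le:
  assumes "(x, y, z) \<noteq> (0, 0, 0)" and "r > 0"
    and "\<And>g. rotation_matrix g \<Longrightarrow>
      mat_exp (r *\<^sub>R so3_matrix x y z) ** g = g ** mat_exp (r *\<^sub>R so3_matrix x y z)"
  shows "2 * pi / sqrt (x\<^sup>2 + y\<^sup>2 + z\<^sup>2) \<le> r"
proof -
  interpret rotation_generator "so3_matrix x y z" "sqrt (x\<^sup>2 + y\<^sup>2 + z\<^sup>2)"
    by (rule rotation_generator_so3)
  let ?E = "mat_exp (r *\<^sub>R so3_matrix x y z)"
  let ?v = "vector [x, y, z] :: real^3"
  obtain l where l: "?E = l *\<^sub>R mat 1"
    using commutes_rotations_imp_scalar assms(3) by blast
  have "l *\<^sub>R ?v = ?v"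
    using mat_exp_so3_axis[of r x y z] by (simp add: l scaleR_matrix_vector_assoc[symmetric])
  moreover have "?v \<noteq> 0"
    using assms(1) by (auto simp: vec_eq_iff forall_3)
  ultimately have "l = 1"
    by (metis scaleR_cancel_right scaleR_one)
  moreover have "sqrt (x\<^sup>2 + y\<^sup>2 + z\<^sup>2) > 0"
    using assms(1) by (auto simp: add_nonneg_eq_0_iff less_le)
  ultimately show ?thesis
    using period_le l assms(2) by simp
qed

section \<open>Right invariant fields and the associated linear field\<close>

lemma rotation_matrix_invertible:
  fixes g :: "real^'n^'n"
  assumes "rotation_matrix g"
  shows "det g \<noteq> 0" "invertible g"
  using assms by (auto simp: rotation_matrix_def invertible_det_nz)

lemma right_invariant_field_eq:
  assumes "right_invariant_field Y" and "rotation_matrix g"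
  shows "Y g = Y (mat 1) ** g"
proof -
  have "((\<lambda>a. a ** g) has_derivative (\<lambda>a. a ** g)) (at p)" for p :: mat3
    by (rule bounded_linear_imp_has_derivative[OF matrix_mult.bounded_linear_left])
  from frechet_derivative_at[OF this]
  have "frechet_derivative (\<lambda>a. a ** g) (at p) = (\<lambda>a. a ** g)" for p :: mat3
    by simp
  \<comment> \<open>Translating by \<open>g\<close> itself puts the base point at
    \<open>g ** matrix_inv g = mat 1\<close>; right translation is linear, hence its own
    derivative.\<close>
  moreover have "pushforward (\<lambda>a. a ** g) (\<lambda>a. a ** matrix_inv g) Y g = Y g"
    using assms by (simp add: right_invariant_field_def SO3_def)
  ultimately show ?thesis
    using assms by (simp add: pushforward_def matrix_inv_mult rotation_matrix_invertible)
qed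

lemma rotation_matrix_inv:
  fixes g :: "real^'n^'n"
  assumes "rotation_matrix g"
  shows "rotation_matrix (matrix_inv g)" "matrix_inv (matrix_inv g) = g"
proof -
  have "g ** transpose g = mat 1"
    using assms by (simp add: rotation_matrix_def orthogonal_matrix_def)
  then have "matrix_inv g = transpose g"
    by (rule matrix_inv_unique)
  then show "rotation_matrix (matrix_inv g)"
    using assms by (simp add: rotation_matrix_def)
  show "matrix_inv (matrix_inv g) = g"
    using assms by (intro matrix_inv_unique) (simp add: matrix_inv_mult rotation_matrix_invertible)
qed

text \<open>At \<open>matrix_inv g\<close> the differential of inversion sends \<open>H\<close> to
  \<open>- (g ** H ** g)\<close>. Here \<open>H\<close> is \<open>Y (mat 1) ** matrix_inv g\<close>
  by right invariance, and the inverse cancels.\<close>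

lemma associated_field_eq_commutator:
  assumes "associated_right_invariant_field V Y" and "rotation_matrix g"
  shows "V g = Y (mat 1) ** g - g ** Y (mat 1)"
proof -
  note rg = rotation_matrix_inv[OF assms(2)]
  have Y: "right_invariant_field Y"
    and "V g = Y g + pushforward matrix_inv matrix_inv Y g"
    using assms by (auto simp: associated_right_invariant_field_def SO3_def)
  moreover have "pushforward matrix_inv matrix_inv Y g = - (g ** Y (matrix_inv g) ** g)"
    using rg by (simp add: pushforward_def frechet_derivative_matrix_inv rotation_matrix_invertible)
  moreover have "g ** (Y (mat 1) ** matrix_inv g) ** g = g ** Y (mat 1) ** (matrix_inv g ** g)"
    by (simp only: matrix_mul_assoc)
  ultimately show ?thesis
    using assms(2) rg by (simp add: right_invariant_field_eq[OF Y] matrix_inv_mult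
        rotation_matrix_invertible)
qed

section \<open>Periodicity of the invariant and the linear flow\<close>

text \<open>A moving orbit of \<open>\<phi>\<close> may close before \<open>T\<close>, so for
  \<open>\<phi>\<close> minimality is claimed of the common period. For \<open>x = y = z = 0\<close>
  the value of \<open>T\<close> is 0, which is no period; the last clause excludes this case, and in
  the others no orbit moves then.\<close>

theorem proposition5p2:
  fixes V Y :: "mat3 \<Rightarrow> mat3" and \<phi> :: "real \<Rightarrow> mat3 \<Rightarrow> mat3" and x y z :: real
  assumes "linear_vector_field SO3 V"
    and "is_flow_on (carrier SO3) V \<phi>"
    and "associated_right_invariant_field V Y"
    and "Y (mat 1) = so3_matrix x y z"
  defines "\<psi> \<equiv> invariant_flow (so3_matrix x y z)"
    and "T \<equiv> 2 * pi / sqrt (x\<^sup>2 + y\<^sup>2 + z\<^sup>2)"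
  shows "(\<forall>g\<in>carrier SO3. \<not> fixed_point \<psi> g \<longrightarrow> periodic_orbit \<psi> g)
    \<and> (\<forall>g\<in>carrier SO3. \<not> fixed_point \<phi> g \<longrightarrow> periodic_orbit \<phi> g)
    \<and> (\<forall>g\<in>carrier SO3. \<not> fixed_point \<psi> g \<longrightarrow> least_period (\<lambda>t. \<psi> t g) T)
    \<and> (\<forall>g\<in>carrier SO3. \<not> fixed_point \<phi> g \<longrightarrow> is_period (\<lambda>t. \<phi> t g) T)
    \<and> ((x, y, z) \<noteq> (0, 0, 0) \<longrightarrow> flow_period (carrier SO3) \<phi> T)"
proof -
  define X where "X = so3_matrix x y z"
  define w where "w = sqrt (x\<^sup>2 + y\<^sup>2 + z\<^sup>2)"
  define E where "E = (\<lambda>t. mat_exp (t *\<^sub>R X))"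
  interpret rotation_generator X w
    unfolding X_def w_def by (rule rotation_generator_so3)
  have T: "T = 2 * pi / w"
    by (simp add: T_def w_def)
  have "w \<ge> 0"
    by (simp add: w_def)
  have \<psi>: "\<psi> t g = E t ** g" for t g
    by (simp add: \<psi>_def invariant_flow_def E_def X_def)
  \<comment> \<open>\<open>\<phi>\<close> is given only as a flow of \<open>V\<close>; its orbits
    solve the commutator equation, which determines them.\<close>
  have \<phi>: "\<phi> t g = E t ** g ** E (- t)" if "g \<in> carrier SO3" for t g
  proof -
    have \<phi>0: "\<phi> 0 g = g"
      and rot: "\<And>s. rotation_matrix (\<phi> s g)"
      and der: "\<And>s. ((\<lambda>t. \<phi> t g) has_vector_derivative V (\<phi> s g)) (at s)"
      using assms(2) that by (auto simp: is_flow_on_def SO3_def)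
    have "((\<lambda>t. \<phi> t g) has_vector_derivative X ** \<phi> s g - \<phi> s g ** X) (at s)" for s
      using der[of s] associated_field_eq_commutator[OF assms(3) rot] assms(4)
      by (simp add: X_def)
    from conjugation_flow[OF this] show ?thesis
      by (simp add: \<phi>0 E_def)
  qed
  have E_inv: "E t ** E (- t) = mat 1" "E (- t) ** E t = mat 1" for t
    using mat_exp_inverse[of t] mat_exp_inverse[of "- t"] by (simp_all add: E_def)
  have E_0: "E 0 = mat 1"
    by (simp add: E_def mat_exp_0)
  have E_still: "E t = mat 1" if "w = 0" for t
    using that by (simp add: E_def mat_exp_0 speed_0)
  have E_T: "E (t + T) = E t" "E (- t - T) = E (- t)" if "w \<noteq> 0" for t
    unfolding E_def T using mat_exp_periodic[OF that, of t]
      mat_exp_periodic[OF that, of "- t - 2 * pi / w"] by simp_all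
  have "T > 0" if "w \<noteq> 0"
    using that \<open>w \<ge> 0\<close> by (simp add: T)
  then have \<psi>_T: "is_period (\<lambda>t. \<psi> t g) T"
    and \<phi>_T: "g \<in> carrier SO3 \<Longrightarrow> is_period (\<lambda>t. \<phi> t g) T" if "w \<noteq> 0" for g
    using that by (simp_all add: is_period_def \<psi> \<phi> E_T)
  \<comment> \<open>Cancelling \<open>g\<close> at time 0 turns a period of one orbit into
    \<open>E r = mat 1\<close>, so \<open>period_le\<close> applies to each orbit
    separately.\<close>
  have least: "T \<le> r" if g: "g \<in> carrier SO3" and "w \<noteq> 0" and r: "is_period (\<lambda>t. \<psi> t g) r" for g r
  proof -
    have "E (0 + r) ** g = E 0 ** g"
      using r unfolding is_period_def \<psi> by blast
    then have "E r ** g ** matrix_inv g = g ** matrix_inv g"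
      by (simp add: E_0)
    then have "E r = mat 1"
      using g by (simp add: SO3_def matrix_mul_assoc[symmetric] matrix_inv_mult
          rotation_matrix_invertible)
    then show ?thesis
      using period_le[of r] r \<open>w \<noteq> 0\<close> \<open>w \<ge> 0\<close> by (simp add: E_def T is_period_def)
  qed
  have moving_\<psi>: "w \<noteq> 0" if "\<not> fixed_point \<psi> g" for g
    using that E_still by (auto simp: fixed_point_def \<psi>)
  have moving_\<phi>: "w \<noteq> 0" if "\<not> fixed_point \<phi> g" "g \<in> carrier SO3" for g
    using that E_still by (auto simp: fixed_point_def \<phi>)
  have flow: "flow_period (carrier SO3) \<phi> T" if nz: "(x, y, z) \<noteq> (0, 0, 0)"
    unfolding flow_period_def
  proof (intro conjI allI impI ballI)
    have "w \<noteq> 0"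
      using nz by (auto simp: w_def add_nonneg_eq_0_iff)
    then show "is_period (\<lambda>t. \<phi> t g) T" if "g \<in> carrier SO3" for g
      using that by (rule \<phi>_T)
    fix r
    assume r: "\<forall>g\<in>carrier SO3. is_period (\<lambda>t. \<phi> t g) r"
    have "E r ** g = g ** E r" if "rotation_matrix g" for g
    proof -
      have g: "g \<in> carrier SO3"
        using that by (simp add: SO3_def)
      \<comment> \<open>Closing up at time \<open>r\<close> says that conjugation by
        \<open>E r\<close> fixes \<open>g\<close>, that is, that the two commute.\<close>
      with r have "\<phi> (0 + r) g = \<phi> 0 g"
        unfolding is_period_def by blast
      then have "E r ** g ** E (- r) ** E r = g ** E r"
        by (simp add: \<phi>[OF g] E_0)
      then show ?thesis
        by (simp add: matrix_mul_assoc[symmetric] E_inv)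
    qed
    \<comment> \<open>Positivity of \<open>r\<close> is part of being a period of some orbit, so one
      element of the group is needed to extract it.\<close>
    moreover have "mat 1 \<in> carrier SO3"
      by (simp add: SO3_def rotation_matrix_def orthogonal_matrix_id)
    with r have "r > 0"
      by (auto simp: is_period_def)
    ultimately show "T \<le> r"
      unfolding T_def using conjugation_period_le[OF nz] by (simp add: E_def X_def)
  qed
  have \<psi>_period: "is_period (\<lambda>t. \<psi> t g) T" if "\<not> fixed_point \<psi> g" for g
    using that by (intro \<psi>_T moving_\<psi>)
  have \<phi>_period: "is_period (\<lambda>t. \<phi> t g) T" if "g \<in> carrier SO3" "\<not> fixed_point \<phi> g" for g
    using that by (intro \<phi>_T moving_\<phi>)
  have "least_period (\<lambda>t. \<psi> t g) T" if "g \<in> carrier SO3" "\<not> fixed_point \<psi> g" for g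
    unfolding least_period_def
    using least[OF that(1) moving_\<psi>[OF that(2)]] \<psi>_period[OF that(2)] by simp
  moreover have "periodic_orbit \<psi> g" if "\<not> fixed_point \<psi> g" for g
    unfolding periodic_orbit_def using \<psi>_period[OF that] by (rule exI)
  moreover have "periodic_orbit \<phi> g" if "g \<in> carrier SO3" "\<not> fixed_point \<phi> g" for g
    unfolding periodic_orbit_def using \<phi>_period[OF that] by (rule exI)
  ultimately show ?thesis
    using \<phi>_period flow by simp
qed

end
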